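(* Let $T$ be a $C_0$-semigroup on a complex Banach space $X$ satisfying lower bounds, and let $c>0$ and $\alpha\in\mathbb{R}$ be such that $$\|T(t)x\| \ge c e^{-\alpha t} \|x\| \qquad (x \in X,\ t>0).$$ For each $\omega > \alpha$, there exist a $C_0$-group extension $S$ of $T$ on a Banach space $Y \supseteq X$ and a constant $M\ge1$ such that $\|S(t)\| = \|T(t)\|$ and $\|S(-t)\| \le Me^{\omega t}$ for all $t>0$.
   Context: All Banach spaces are complex. $Y \supseteq X$ means that $X$ is a closed subspace of $Y$ with the same norm (up to identification via a linear isometric embedding of $X$ into $Y$). A $C_0$-semigroup $T$ on $X$ satisfies lower bounds if there is a function $t\mapsto c(t)\in(0,\infty)$ such that $\|T(t)x\|\ge c(t)\|x\|$ for all $x\in X$, $t\ge0$. A $C_0$-group $S$ on $Y\supseteq X$ is a $C_0$-group extension of $T$ on $Y$ if $X$ is invariant under $S(t)$ and $T(t)=S(t)|_X$ for all $t\ge0$. *)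

theory Defs
  imports "HOL-Analysis.Analysis"
begin

section \<open>Complex Banach spaces as a type class\<close>

text \<open>The real scaling of \<^class>\<open>banach\<close> is required to be the restriction of the complex one.\<close>

class complex_banach = banach +
  fixes scaleC :: "complex \<Rightarrow> 'a \<Rightarrow> 'a"  (infixr "*\<^sub>C" 75)
  assumes scaleC_add_right: "a *\<^sub>C (x + y) = a *\<^sub>C x + a *\<^sub>C y"
    and scaleC_add_left: "(a + b) *\<^sub>C x = a *\<^sub>C x + b *\<^sub>C x"
    and scaleC_scaleC: "a *\<^sub>C (b *\<^sub>C x) = (a * b) *\<^sub>C x"
    and scaleC_one: "1 *\<^sub>C x = x"
    and scaleC_of_real: "complex_of_real r *\<^sub>C x = r *\<^sub>R x"
    and norm_scaleC: "norm (a *\<^sub>C x) = cmod a * norm x"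

definition bounded_clinear ::
  "('a::complex_banach \<Rightarrow> 'a) \<Rightarrow> bool" where
  "bounded_clinear f \<longleftrightarrow> bounded_linear f \<and> (\<forall>a x. f (a *\<^sub>C x) = a *\<^sub>C f x)"

text \<open>
  A semigroup is a function on all of \<^typ>\<open>real\<close>, but only its values at \<open>t \<ge> 0\<close> matter.
\<close>

definition C0_semigroup :: "(real \<Rightarrow> 'a::complex_banach \<Rightarrow> 'a) \<Rightarrow> bool" where
  "C0_semigroup T \<longleftrightarrow>
     (\<forall>t\<ge>0. bounded_clinear (T t)) \<and>
     (\<forall>x. T 0 x = x) \<and>
     (\<forall>s\<ge>0. \<forall>t\<ge>0. \<forall>x. T (s + t) x = T s (T t x)) \<and>
     (\<forall>x. ((\<lambda>t. T t x) \<longlongrightarrow> x) (at_right 0))"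

definition lower_bounds :: "(real \<Rightarrow> 'a::complex_banach \<Rightarrow> 'a) \<Rightarrow> bool" where
  "lower_bounds T \<longleftrightarrow>
     (\<exists>c :: real \<Rightarrow> real. \<forall>t\<ge>0. c t > 0 \<and> (\<forall>x. norm (T t x) \<ge> c t * norm x))"

section \<open>Complex Banach spaces on a carrier set\<close>

text \<open>
  The extension space is existentially quantified. Since HOL cannot quantify over types, it is
  represented by an explicit carrier set with its own operations.
\<close>

record 'b cspace =
  points :: "'b set"
  addv :: "'b \<Rightarrow> 'b \<Rightarrow> 'b"
  zerov :: "'b"
  scalev :: "complex \<Rightarrow> 'b \<Rightarrow> 'b"
  normv :: "'b \<Rightarrow> real"

definition diffv :: "'b cspace \<Rightarrow> 'b \<Rightarrow> 'b \<Rightarrow> 'b" where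
  "diffv Y x y = addv Y x (scalev Y (- 1) y)"

text \<open>
  The value off the carrier is irrelevant, but \<^locale>\<open>Metric_space\<close> demands symmetry and
  nonnegativity on the whole type.
\<close>

definition distv :: "'b cspace \<Rightarrow> 'b \<Rightarrow> 'b \<Rightarrow> real" where
  "distv Y x y = (if x \<in> points Y \<and> y \<in> points Y then normv Y (diffv Y x y) else 0)"

locale normed_cspace =
  fixes Y :: "'b cspace"
  assumes zero_closed: "zerov Y \<in> points Y"
    and add_closed: "\<lbrakk>x \<in> points Y; y \<in> points Y\<rbrakk> \<Longrightarrow> addv Y x y \<in> points Y"
    and scale_closed: "x \<in> points Y \<Longrightarrow> scalev Y a x \<in> points Y"
    and add_assoc: "\<lbrakk>x \<in> points Y; y \<in> points Y; z \<in> points Y\<rbrakk> \<Longrightarrow>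
          addv Y (addv Y x y) z = addv Y x (addv Y y z)"
    and add_commute: "\<lbrakk>x \<in> points Y; y \<in> points Y\<rbrakk> \<Longrightarrow> addv Y x y = addv Y y x"
    and add_zero: "x \<in> points Y \<Longrightarrow> addv Y x (zerov Y) = x"
    and add_inverse: "x \<in> points Y \<Longrightarrow> \<exists>y\<in>points Y. addv Y x y = zerov Y"
    and scale_add_right: "\<lbrakk>x \<in> points Y; y \<in> points Y\<rbrakk> \<Longrightarrow>
          scalev Y a (addv Y x y) = addv Y (scalev Y a x) (scalev Y a y)"
    and scale_add_left: "x \<in> points Y \<Longrightarrow>
          scalev Y (a + b) x = addv Y (scalev Y a x) (scalev Y b x)"
    and scale_scale: "x \<in> points Y \<Longrightarrow> scalev Y a (scalev Y b x) = scalev Y (a * b) x"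
    and scale_one: "x \<in> points Y \<Longrightarrow> scalev Y 1 x = x"
    and norm_nonneg: "x \<in> points Y \<Longrightarrow> 0 \<le> normv Y x"
    and norm_eq_zero: "x \<in> points Y \<Longrightarrow> normv Y x = 0 \<longleftrightarrow> x = zerov Y"
    and norm_triangle: "\<lbrakk>x \<in> points Y; y \<in> points Y\<rbrakk> \<Longrightarrow>
          normv Y (addv Y x y) \<le> normv Y x + normv Y y"
    and norm_scale: "x \<in> points Y \<Longrightarrow> normv Y (scalev Y a x) = cmod a * normv Y x"
begin

lemma scale_zero: "x \<in> points Y \<Longrightarrow> scalev Y 0 x = zerov Y"
  using norm_eq_zero[OF scale_closed, of x 0] norm_scale[of x 0] by simp

lemma diff_closed: "\<lbrakk>x \<in> points Y; y \<in> points Y\<rbrakk> \<Longrightarrow> diffv Y x y \<in> points Y"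
  by (simp add: diffv_def add_closed scale_closed)

lemma add_neg:
  assumes "x \<in> points Y"
  shows "addv Y x (scalev Y (- 1) x) = zerov Y"
  using scale_add_left[OF assms, of 1 "- 1"] scale_one[OF assms] scale_zero[OF assms] by simp

lemma neg_diff:
  assumes "x \<in> points Y" "y \<in> points Y"
  shows "scalev Y (- 1) (diffv Y x y) = diffv Y y x"
proof -
  have "scalev Y (- 1) (diffv Y x y) = addv Y (scalev Y (- 1) x) y"
    using assms by (simp add: diffv_def scale_add_right scale_closed scale_scale scale_one)
  then show ?thesis
    using assms by (simp add: diffv_def add_commute scale_closed)
qed

lemma diff_add_diff:
  assumes "x \<in> points Y" "y \<in> points Y" "z \<in> points Y"
  shows "addv Y (diffv Y x y) (diffv Y y z) = diffv Y x z"
proof -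
  let ?n = "scalev Y (- 1)"
  have n: "?n y \<in> points Y" "?n z \<in> points Y"
    using assms by (auto intro: scale_closed)
  have "addv Y (?n y) (addv Y y (?n z)) = addv Y (addv Y (?n y) y) (?n z)"
    using assms n by (simp add: add_assoc)
  also have "addv Y (?n y) y = zerov Y"
    using assms n add_neg add_commute by metis
  also have "addv Y (zerov Y) (?n z) = ?n z"
    using n zero_closed add_zero add_commute by metis
  finally show ?thesis
    using assms n by (simp add: diffv_def add_assoc add_closed)
qed

lemma diff_eq_zero:
  assumes "x \<in> points Y" "y \<in> points Y"
  shows "diffv Y x y = zerov Y \<longleftrightarrow> x = y"
proof
  assume z: "diffv Y x y = zerov Y"
  have n: "scalev Y (- 1) y \<in> points Y"
    using assms by (auto intro: scale_closed)
  have "addv Y (diffv Y x y) y = addv Y x (addv Y (scalev Y (- 1) y) y)"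
    using assms n by (simp add: diffv_def add_assoc)
  also have "addv Y (scalev Y (- 1) y) y = zerov Y"
    using assms n add_neg add_commute by metis
  finally have "addv Y (zerov Y) y = x"
    using z assms add_zero by simp
  then show "x = y"
    using assms zero_closed add_zero add_commute by metis
next
  show "x = y \<Longrightarrow> diffv Y x y = zerov Y"
    using assms by (simp add: diffv_def add_neg)
qed

sublocale Metric_space "points Y" "distv Y"
proof
  show "0 \<le> distv Y x y" for x y
    by (simp add: distv_def norm_nonneg diff_closed)
  show "distv Y x y = distv Y y x" for x y
  proof (cases "x \<in> points Y \<and> y \<in> points Y")
    case True
    then have "normv Y (diffv Y y x) = cmod (- 1) * normv Y (diffv Y x y)"
      using neg_diff norm_scale diff_closed by metis
    then show ?thesis
      by (simp add: distv_def)
  qed (auto simp: distv_def)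
  show "distv Y x y = 0 \<longleftrightarrow> x = y" if "x \<in> points Y" "y \<in> points Y" for x y
    using that by (simp add: distv_def norm_eq_zero diff_closed diff_eq_zero)
  show "distv Y x z \<le> distv Y x y + distv Y y z"
    if "x \<in> points Y" "y \<in> points Y" "z \<in> points Y" for x y z
    using that norm_triangle[OF diff_closed diff_closed, of x y y z] diff_add_diff[of x y z]
    by (simp add: distv_def)
qed

end

locale banach_cspace = normed_cspace +
  assumes complete: "mcomplete"

definition bounded_op :: "'b cspace \<Rightarrow> ('b \<Rightarrow> 'b) \<Rightarrow> bool" where
  "bounded_op Y A \<longleftrightarrow>
     (\<forall>x\<in>points Y. A x \<in> points Y) \<and>
     (\<forall>x\<in>points Y. \<forall>y\<in>points Y. A (addv Y x y) = addv Y (A x) (A y)) \<and>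
     (\<forall>a. \<forall>x\<in>points Y. A (scalev Y a x) = scalev Y a (A x)) \<and>
     (\<exists>K. \<forall>x\<in>points Y. normv Y (A x) \<le> K * normv Y x)"

text \<open>
  The analogue of \<^const>\<open>onorm\<close>; the zero vector contributes \<open>0 / 0 = 0\<close>, so the norm is \<open>0\<close> on
  the zero space.
\<close>

definition opnorm :: "'b cspace \<Rightarrow> ('b \<Rightarrow> 'b) \<Rightarrow> real" where
  "opnorm Y A = (SUP x\<in>points Y. normv Y (A x) / normv Y x)"

definition C0_group :: "'b cspace \<Rightarrow> (real \<Rightarrow> 'b \<Rightarrow> 'b) \<Rightarrow> bool" where
  "C0_group Y S \<longleftrightarrow>
     (\<forall>t. bounded_op Y (S t)) \<and>
     (\<forall>y\<in>points Y. S 0 y = y) \<and>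
     (\<forall>s t. \<forall>y\<in>points Y. S (s + t) y = S s (S t y)) \<and>
     (\<forall>y\<in>points Y. ((\<lambda>t. distv Y (S t y) y) \<longlongrightarrow> 0) (at 0))"

section \<open>Extensions\<close>

text \<open>
  \<open>isometric_embedding Y J\<close> renders \<open>Y \<supseteq> X\<close>, with \<open>X\<close> the type \<^typ>\<open>'a\<close>. The image of \<open>J\<close> is
  closed in \<open>Y\<close> automatically, because \<open>X\<close> is complete.
\<close>

definition isometric_embedding :: "'b cspace \<Rightarrow> ('a::complex_banach \<Rightarrow> 'b) \<Rightarrow> bool" where
  "isometric_embedding Y J \<longleftrightarrow>
     (\<forall>x. J x \<in> points Y) \<and>
     (\<forall>x y. J (x + y) = addv Y (J x) (J y)) \<and>
     (\<forall>a x. J (a *\<^sub>C x) = scalev Y a (J x)) \<and>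
     (\<forall>x. normv Y (J x) = norm x)"

definition C0_group_extension ::
  "(real \<Rightarrow> 'a::complex_banach \<Rightarrow> 'a) \<Rightarrow> 'b cspace \<Rightarrow> ('a \<Rightarrow> 'b) \<Rightarrow> (real \<Rightarrow> 'b \<Rightarrow> 'b) \<Rightarrow> bool" where
  "C0_group_extension T Y J S \<longleftrightarrow>
     C0_group Y S \<and>
     (\<forall>t\<ge>0. S t ` range J \<subseteq> range J) \<and>
     (\<forall>t\<ge>0. \<forall>x. S t (J x) = J (T t x))"

text \<open>
  The type of points for extension spaces of \<^typ>\<open>'a\<close>. Fixing it loses no generality: every
  extension \<open>S\<close> restricts to the closed linear span of the spaces \<open>S (- n) X\<close> for natural \<open>n\<close>.
  These spaces increase with \<open>n\<close>, so each point of the closure is the limit of some \<open>S (- n) (x n)\<close>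
  with \<open>x\<close> a sequence in \<open>X\<close>, and the closure has at most as many points as there are such
  sequences.
\<close>

type_synonym 'a ext_point = "(real \<Rightarrow> 'a) set"

end

theory Submission
  imports Defs
begin

text \<open>
  Since \<open>\<omega> > \<alpha>\<close>, there is a time \<open>\<tau> > 0\<close> with \<open>c exp (- \<alpha> \<tau>) \<ge> exp (- \<omega> \<tau>)\<close>. For the single
  operator \<open>U = exp (\<omega> \<tau>) T \<tau>\<close> the lower bound then reads \<open>norm (U x) \<ge> norm x\<close>, without a
  constant. The extension adjoins an inverse \<open>V\<close> of \<open>U\<close> with norm at most 1, in the most generous way:
  \<open>Y\<close> consists of the series of vectors \<open>V\<^sup>n (f n)\<close>, where \<open>f\<close> is an absolutely summable sequence in
  \<open>X\<close>. Formally, \<open>Y\<close> is the quotient of the space of such sequences by the closure \<open>K\<close> of the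
  sequences \<open>R d = U (shift d) - d\<close>, where \<open>shift\<close>, inserting a 0 in front, plays the role of \<open>V\<close>.

  The inclusion of \<open>X\<close> as \<open>(x, 0, 0, \<dots>)\<close> is isometric because \<open>U\<close> does not decrease norms: the
  estimate of \<open>norm ((x, 0, 0, \<dots>) - R d)\<close> from below telescopes (lemma \<open>norm_delta_minus_R\<close>). For
  \<open>t \<ge> 0\<close> the operator \<open>T t\<close> acts on each coordinate of a sequence and commutes with \<open>R\<close>, so it
  descends to \<open>Y\<close> with norm at most that of \<open>T t\<close>, hence with equal norm because \<open>X\<close> is contained
  isometrically in \<open>Y\<close>. On \<open>Y\<close> the inverse of \<open>T \<tau>\<close> is induced by \<open>exp (\<omega> \<tau>) shift\<close>. Any negative
  time is \<open>s - n \<tau>\<close> with \<open>0 \<le> s \<le> \<tau>\<close>, so that the extension at this time is bounded by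
  \<open>exp (\<omega> \<tau> n)\<close> times the supremum of the norms of \<open>T\<close> on \<open>[0, \<tau>]\<close> (lemma \<open>norm_S_neg\<close>). That this
  supremum is finite is the uniform boundedness principle.
\<close>

section \<open>Local boundedness of semigroups\<close>

text \<open>
  The uniform boundedness principle: by the Baire category theorem one of the closed sets
  \<open>F N\<close> contains a ball, and a bound on a ball rescales to a bound on the operators.
\<close>

lemma banach_steinhaus:
  fixes f :: "nat \<Rightarrow> 'a::banach \<Rightarrow> 'b::real_normed_vector"
  assumes lin: "\<And>n. bounded_linear (f n)"
    and ptw: "\<And>x. bounded (range (\<lambda>n. f n x))"
  shows "\<exists>B. \<forall>n x. norm (f n x) \<le> B * norm x"
proof -
  define F where "F N = (\<Inter>n. {x. norm (f n x) \<le> real N})" for N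
  have "closed {x. norm (f n x) \<le> real N}" for n N
    by (intro closed_Collect_le continuous_intros linear_continuous_on lin)
  then have closed: "closed (F N)" for N
    by (auto simp: F_def)
  have cover: "(\<Union>N. F N) = UNIV"
  proof -
    have "\<exists>N. x \<in> F N" for x
    proof -
      obtain B where "norm (f n x) \<le> B" for n
        using ptw[of x] by (auto simp: bounded_iff)
      then have "norm (f n x) \<le> real (nat \<lceil>B\<rceil>)" for n
        using real_nat_ceiling_ge order_trans by blast
      then show ?thesis
        by (auto simp: F_def)
    qed
    then show ?thesis by auto
  qed
  have "\<exists>N. interior (F N) \<noteq> {}"
  proof (rule ccontr)
    assume "\<nexists>N. interior (F N) \<noteq> {}"
    then have "euclidean interior_of \<Union>(range F) = {}"
      using closed
      by (intro Baire_category_alt disjI1 completely_metrizable_space_euclidean) auto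
    then show False
      using cover by simp
  qed
  then obtain N a r where r: "r > 0" and ball: "ball a r \<subseteq> F N"
    by (metis all_not_in_conv mem_interior)
  \<comment> \<open>A vector of norm less than \<open>r\<close> is a difference of two points of the ball, hence the factor 2.\<close>
  have small: "norm (f n y) \<le> 2 * real N" if "norm y < r" for n y
  proof -
    have "a + y \<in> F N" "a \<in> F N"
      using that r ball by (auto simp: dist_norm subset_iff)
    then have "norm (f n (a + y)) \<le> N" "norm (f n a) \<le> N"
      by (auto simp: F_def)
    moreover have "f n y = f n (a + y) - f n a"
      using lin by (simp add: linear_simps)
    ultimately show ?thesis
      using norm_triangle_ineq4[of "f n (a + y)" "f n a"] by simp
  qed
  have "norm (f n x) \<le> (4 * real N / r) * norm x" for n x
  proof (cases "x = 0")
    case True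
    then show ?thesis
      using lin by (simp add: linear_simps)
  next
    case False
    define s where "s = r / (2 * norm x)"
    have s: "s > 0"
      using False r by (simp add: s_def)
    have "norm (s *\<^sub>R x) < r"
      using False r by (simp add: s_def)
    then have "s * norm (f n x) \<le> 2 * real N"
      using small[of "s *\<^sub>R x" n] lin s by (simp add: linear_simps)
    then show ?thesis
      using False r by (simp add: s_def field_simps)
  qed
  then show ?thesis by blast
qed

lemma C0_semigroup_bounded_clinear: "C0_semigroup T \<Longrightarrow> t \<ge> 0 \<Longrightarrow> bounded_clinear (T t)"
  and C0_semigroup_zero: "C0_semigroup T \<Longrightarrow> T 0 x = x"
  and C0_semigroup_add: "C0_semigroup T \<Longrightarrow> s \<ge> 0 \<Longrightarrow> t \<ge> 0 \<Longrightarrow> T (s + t) x = T s (T t x)"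
  and C0_semigroup_tendsto: "C0_semigroup T \<Longrightarrow> ((\<lambda>t. T t x) \<longlongrightarrow> x) (at_right 0)"
  by (auto simp: C0_semigroup_def)

text \<open>
  Otherwise there are times \<open>t n\<close> tending to 0 at which \<open>T\<close> has norm more than \<open>n\<close>; but the
  orbits converge along \<open>t n\<close>, so the uniform boundedness principle applies to these operators.
\<close>

lemma C0_semigroup_bounded_near_0:
  fixes T :: "real \<Rightarrow> 'a::complex_banach \<Rightarrow> 'a"
  assumes T: "C0_semigroup T"
  shows "\<exists>\<delta>>0. \<exists>B. \<forall>t\<in>{0..\<delta>}. \<forall>x. norm (T t x) \<le> B * norm x"
proof (rule ccontr)
  assume "\<not> ?thesis"
  then have "\<forall>n. \<exists>t. t \<in> {0..inverse (real (Suc n))} \<and> (\<exists>x. norm (T t x) > real n * norm x)"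
    by (metis inverse_positive_iff_positive not_le of_nat_0_less_iff zero_less_Suc)
  then obtain t where t: "\<And>n. t n \<in> {0..inverse (real (Suc n))}"
    and big: "\<And>n. \<exists>x. norm (T (t n) x) > real n * norm x"
    by metis
  have t0: "t \<longlonglongrightarrow> 0"
    by (rule tendsto_sandwich[OF _ _ tendsto_const LIMSEQ_inverse_real_of_nat]) (use t in auto)
  have "bounded (range (\<lambda>n. T (t n) x))" for x
  proof -
    have "continuous (at 0 within {0..}) (\<lambda>t. T t x)"
      using C0_semigroup_tendsto[OF T] C0_semigroup_zero[OF T]
      by (simp add: continuous_within at_within_Ici_at_right)
    then have "((\<lambda>t. T t x) \<circ> t) \<longlonglongrightarrow> T 0 x"
      using t t0 by (auto simp: continuous_within_sequentially)
    then show ?thesis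
      using convergent_imp_bounded by (auto simp: o_def)
  qed
  moreover have "bounded_linear (T (t n))" for n
    using C0_semigroup_bounded_clinear[OF T] t[of n] by (auto simp: bounded_clinear_def)
  ultimately obtain B where B: "\<And>n x. norm (T (t n) x) \<le> B * norm x"
    using banach_steinhaus[of "\<lambda>n. T (t n)"] by blast
  obtain n where "real n \<ge> B"
    using real_arch_simple by blast
  then have "norm (T (t n) x) \<le> real n * norm x" for x
    using B[of n x] by (meson mult_right_mono norm_ge_zero order_trans)
  then show False
    using big[of n] by (meson not_le)
qed

text \<open>
  A bound near 0 spreads to compact intervals because \<open>T t\<close> is a product of operators at small
  times.
\<close>

lemma C0_semigroup_bounded_on_compact:
  fixes T :: "real \<Rightarrow> 'a::complex_banach \<Rightarrow> 'a"
  assumes T: "C0_semigroup T"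
  shows "\<exists>B\<ge>1. \<forall>t\<in>{0..\<tau>}. \<forall>x. norm (T t x) \<le> B * norm x"
proof -
  obtain \<delta> B where \<delta>: "\<delta> > 0" and "\<And>t x. t \<in> {0..\<delta>} \<Longrightarrow> norm (T t x) \<le> B * norm x"
    using C0_semigroup_bounded_near_0[OF T] by blast
  moreover define D where "D = max 1 B"
  ultimately have D: "norm (T t x) \<le> D * norm x" if "t \<in> {0..\<delta>}" for t x
    using that by (smt (verit) mult_right_mono norm_ge_zero)
  have D1: "D \<ge> 1"
    by (simp add: D_def)
  have "norm (T t x) \<le> D ^ Suc n * norm x" if "t \<in> {0..real n * \<delta>}" for n t x
    using that
  proof (induction n arbitrary: t x)
    case 0
    then show ?case
      using D[of t x] \<delta> by simp
  next
    case (Suc n)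
    show ?case
    proof (cases "t \<le> \<delta>")
      case True
      then have "norm (T t x) \<le> D * norm x"
        using Suc.prems D by auto
      also have "\<dots> \<le> D ^ Suc (Suc n) * norm x"
        using D1 by (intro mult_right_mono self_le_power) auto
      finally show ?thesis .
    next
      case False
      then have "T t x = T \<delta> (T (t - \<delta>) x)"
        using C0_semigroup_add[OF T, of \<delta> "t - \<delta>" x] \<delta> by simp
      then have "norm (T t x) \<le> D * norm (T (t - \<delta>) x)"
        using D[of \<delta>] \<delta> by simp
      also have "\<dots> \<le> D * (D ^ Suc n * norm x)"
        using D1 Suc.prems False by (intro mult_left_mono Suc.IH) (auto simp: algebra_simps)
      finally show ?thesis by simp
    qed
  qed
  moreover obtain n where "\<tau> \<le> real n * \<delta>"
    using \<delta> by (metis ex_less_of_nat_mult less_imp_le)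
  ultimately have "\<forall>t\<in>{0..\<tau>}. \<forall>x. norm (T t x) \<le> D ^ Suc n * norm x"
    by force
  moreover have "D ^ Suc n \<ge> 1"
    using D1 by (rule one_le_power)
  ultimately show ?thesis by blast
qed

section \<open>The space of absolutely summable sequences\<close>

typedef (overloaded) 'a ell1 = "{f :: nat \<Rightarrow> 'a::real_normed_vector. summable (\<lambda>n. norm (f n))}"
  morphisms coord Ell1
  by (rule exI[of _ "\<lambda>_. 0"]) simp

setup_lifting type_definition_ell1

lemma summable_norm_coord [simp, intro]: "summable (\<lambda>n. norm (coord f n))"
  using coord[of f] by simp

lemma ell1_eqI: "(\<And>n. coord f n = coord g n) \<Longrightarrow> f = g"
  by (simp add: coord_inject[symmetric] fun_eq_iff)

lemma summable_norm_add:
  fixes f g :: "nat \<Rightarrow> 'a::real_normed_vector"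
  assumes "summable (\<lambda>n. norm (f n))" "summable (\<lambda>n. norm (g n))"
  shows "summable (\<lambda>n. norm (f n + g n))"
  by (rule summable_comparison_test'[OF summable_add[OF assms], of 0]) (simp add: norm_triangle_ineq)

instantiation ell1 :: (real_normed_vector) real_normed_vector
begin

lift_definition zero_ell1 :: "'a ell1" is "\<lambda>_. 0"
  by simp

lift_definition plus_ell1 :: "'a ell1 \<Rightarrow> 'a ell1 \<Rightarrow> 'a ell1" is "\<lambda>f g n. f n + g n"
  by (rule summable_norm_add)

lift_definition minus_ell1 :: "'a ell1 \<Rightarrow> 'a ell1 \<Rightarrow> 'a ell1" is "\<lambda>f g n. f n - g n"
  using summable_norm_add[of _ "\<lambda>n. - _ n"] by simp

lift_definition uminus_ell1 :: "'a ell1 \<Rightarrow> 'a ell1" is "\<lambda>f n. - f n"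
  by simp

lift_definition scaleR_ell1 :: "real \<Rightarrow> 'a ell1 \<Rightarrow> 'a ell1" is "\<lambda>r f n. r *\<^sub>R f n"
  by (simp add: summable_mult)

lift_definition norm_ell1 :: "'a ell1 \<Rightarrow> real" is "\<lambda>f. \<Sum>n. norm (f n)" .

definition dist_ell1 :: "'a ell1 \<Rightarrow> 'a ell1 \<Rightarrow> real"
  where "dist_ell1 f g = norm (f - g)"

definition sgn_ell1 :: "'a ell1 \<Rightarrow> 'a ell1"
  where "sgn_ell1 f = inverse (norm f) *\<^sub>R f"

definition uniformity_ell1 :: "('a ell1 \<times> 'a ell1) filter"
  where [code del]: "uniformity_ell1 = (INF e\<in>{0<..}. principal {(f, g). dist f g < e})"

definition open_ell1 :: "'a ell1 set \<Rightarrow> bool"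
  where [code del]: "open_ell1 S = (\<forall>f\<in>S. \<forall>\<^sub>F (f', g) in uniformity. f' = f \<longrightarrow> g \<in> S)"

lemma coord_simps [simp]:
  "coord 0 n = 0" "coord (f + g) n = coord f n + coord g n"
  "coord (f - g) n = coord f n - coord g n" "coord (- f) n = - coord f n"
  "coord (r *\<^sub>R f) n = r *\<^sub>R coord f n"
  by (simp_all add: zero_ell1.rep_eq plus_ell1.rep_eq minus_ell1.rep_eq uminus_ell1.rep_eq
      scaleR_ell1.rep_eq)

instance
proof
  fix f g h :: "'a ell1" and a b :: real
  show "f + g + h = f + (g + h)" "f + g = g + f" "0 + f = f" "- f + f = 0" "f - g = f + - g"
    by (rule ell1_eqI, simp add: add_ac)+
  show "a *\<^sub>R (f + g) = a *\<^sub>R f + a *\<^sub>R g" "(a + b) *\<^sub>R f = a *\<^sub>R f + b *\<^sub>R f"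
    "a *\<^sub>R b *\<^sub>R f = (a * b) *\<^sub>R f" "1 *\<^sub>R f = f"
    by (rule ell1_eqI, simp add: scaleR_add_right scaleR_add_left)+
  show "dist f g = norm (f - g)"
    by (rule dist_ell1_def)
  show "uniformity = (INF e\<in>{0<..}. principal {(f, g::'a ell1). dist f g < e})"
    by (rule uniformity_ell1_def)
  show "open S = (\<forall>f\<in>S. \<forall>\<^sub>F (f', g) in uniformity. f' = f \<longrightarrow> g \<in> S)" for S :: "'a ell1 set"
    by (rule open_ell1_def)
  show "norm f = 0 \<longleftrightarrow> f = 0"
    by transfer (simp add: suminf_eq_zero_iff fun_eq_iff)
  show "norm (f + g) \<le> norm f + norm g"
  proof -
    have "(\<Sum>n. norm (coord f n + coord g n)) \<le> (\<Sum>n. norm (coord f n) + norm (coord g n))"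
      by (intro suminf_le norm_triangle_ineq summable_add summable_norm_add summable_norm_coord)
    also have "\<dots> = (\<Sum>n. norm (coord f n)) + (\<Sum>n. norm (coord g n))"
      by (intro suminf_add[symmetric] summable_norm_coord)
    finally show ?thesis
      by (simp add: norm_ell1.rep_eq)
  qed
  show "norm (a *\<^sub>R f) = \<bar>a\<bar> * norm f"
    using suminf_mult[OF summable_norm_coord, of "\<bar>a\<bar>" f]
    by (simp add: norm_ell1.rep_eq)
qed (rule sgn_ell1_def)

end

lemma sum_norm_coord_le: "finite I \<Longrightarrow> (\<Sum>n\<in>I. norm (coord f n)) \<le> norm f"
  by transfer (rule sum_le_suminf; simp)

lemma norm_coord_le: "norm (coord f n) \<le> norm f"
  using sum_norm_coord_le[of "{n}" f] by simp

lemma Ell1_norm_leI: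
  assumes "\<And>N. (\<Sum>n<N. norm (f n)) \<le> B"
  shows "coord (Ell1 f) = f" "norm (Ell1 f) \<le> B"
proof -
  have *: "summable (\<lambda>n. norm (f n))"
    using assms by (rule summableI_nonneg_bounded[rotated]) simp
  then show eq: "coord (Ell1 f) = f"
    by (simp add: Ell1_inverse)
  show "norm (Ell1 f) \<le> B"
    using suminf_le_const[OF * assms] eq by (simp add: norm_ell1.rep_eq)
qed

text \<open>
  The limit is taken coordinatewise. A bound on a difference of two members of the sequence
  survives for each finite partial sum of norms when the second index tends to infinity.
\<close>

instance ell1 :: (banach) banach
proof
  fix F :: "nat \<Rightarrow> 'a ell1"
  assume F: "Cauchy F"
  have "Cauchy (\<lambda>k. coord (F k) n)" for n
  proof (rule CauchyI)
    fix e :: real assume "e > 0"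
    then obtain M where M: "\<And>j k. j \<ge> M \<Longrightarrow> k \<ge> M \<Longrightarrow> norm (F j - F k) < e"
      using CauchyD[OF F] by blast
    have "norm (coord (F j) n - coord (F k) n) < e" if "j \<ge> M" "k \<ge> M" for j k
      using norm_coord_le[of "F j - F k" n] M[OF that] by simp
    then show "\<exists>M. \<forall>j\<ge>M. \<forall>k\<ge>M. norm (coord (F j) n - coord (F k) n) < e"
      by blast
  qed
  then have "convergent (\<lambda>k. coord (F k) n)" for n
    by (rule Cauchy_convergent)
  then have "\<forall>n. \<exists>l. (\<lambda>k. coord (F k) n) \<longlonglongrightarrow> l"
    by (simp add: convergent_def)
  from choice[OF this] obtain g where g: "\<And>n. (\<lambda>k. coord (F k) n) \<longlonglongrightarrow> g n"
    by blast
  have tail: "(\<Sum>n<N. norm (coord (F j) n - g n)) \<le> e"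
    if M: "\<And>k. k \<ge> M \<Longrightarrow> norm (F j - F k) \<le> e" for j M N e
  proof (rule tendsto_upperbound)
    show "(\<lambda>k. \<Sum>n<N. norm (coord (F j) n - coord (F k) n))
        \<longlonglongrightarrow> (\<Sum>n<N. norm (coord (F j) n - g n))"
      by (intro tendsto_intros g)
    have "(\<Sum>n<N. norm (coord (F j) n - coord (F k) n)) \<le> e" if "k \<ge> M" for k
      using sum_norm_coord_le[of "{..<N}" "F j - F k"] M[OF that] by simp
    then show "\<forall>\<^sub>F k in sequentially. (\<Sum>n<N. norm (coord (F j) n - coord (F k) n)) \<le> e"
      by (auto simp: eventually_sequentially)
  qed simp
  obtain M where "\<And>j k. j \<ge> M \<Longrightarrow> k \<ge> M \<Longrightarrow> norm (F j - F k) < 1"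
    using CauchyD[OF F, of 1] by auto
  then have "norm (F M - F k) \<le> 1" if "k \<ge> M" for k
    using that by (intro less_imp_le) auto
  from Ell1_norm_leI(1)[OF tail[OF this]]
  have d: "coord (Ell1 (\<lambda>n. coord (F M) n - g n)) = (\<lambda>n. coord (F M) n - g n)" .
  define G where "G = F M - Ell1 (\<lambda>n. coord (F M) n - g n)"
  have G: "coord G n = g n" for n
    by (simp add: G_def d)
  have "F \<longlonglongrightarrow> G"
  proof (rule LIMSEQ_I)
    fix e :: real assume "e > 0"
    then obtain M where M: "\<And>j k. j \<ge> M \<Longrightarrow> k \<ge> M \<Longrightarrow> norm (F j - F k) < e / 2"
      using CauchyD[OF F, of "e / 2"] by auto
    have "norm (F j - G) < e" if "j \<ge> M" for j
    proof -
      have t: "(\<Sum>n<N. norm (coord (F j) n - g n)) \<le> e / 2" for N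
        using M[OF that] by (intro tail[of M]) (auto intro: less_imp_le)
      have "F j - G = Ell1 (\<lambda>n. coord (F j) n - g n)"
        using Ell1_norm_leI(1)[OF t] by (intro ell1_eqI) (simp add: G)
      then show ?thesis
        using Ell1_norm_leI(2)[OF t] \<open>e > 0\<close> by simp
    qed
    then show "\<exists>M. \<forall>j\<ge>M. norm (F j - G) < e" by blast
  qed
  then show "convergent F"
    by (auto simp: convergent_def)
qed

instantiation ell1 :: (complex_banach) complex_banach
begin

lift_definition scaleC_ell1 :: "complex \<Rightarrow> 'a ell1 \<Rightarrow> 'a ell1" is "\<lambda>a f n. a *\<^sub>C f n"
  by (simp add: norm_scaleC summable_mult)

instance
proof
  fix f g :: "'a ell1" and a b :: complex and r :: real
  show "a *\<^sub>C (f + g) = a *\<^sub>C f + a *\<^sub>C g"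
    by transfer (simp add: scaleC_add_right)
  show "(a + b) *\<^sub>C f = a *\<^sub>C f + b *\<^sub>C f"
    by transfer (simp add: scaleC_add_left)
  show "a *\<^sub>C b *\<^sub>C f = (a * b) *\<^sub>C f"
    by transfer (simp add: scaleC_scaleC)
  show "1 *\<^sub>C f = f"
    by transfer (simp add: scaleC_one)
  show "complex_of_real r *\<^sub>C f = r *\<^sub>R f"
    by transfer (simp add: scaleC_of_real)
  show "norm (a *\<^sub>C f) = cmod a * norm f"
    using suminf_mult[OF summable_norm_coord, of "cmod a" f]
    by (simp only: norm_ell1.rep_eq scaleC_ell1.rep_eq norm_scaleC)
qed

end

lemma coord_scaleC [simp]: "coord (a *\<^sub>C f) n = a *\<^sub>C coord f n"
  by (simp add: scaleC_ell1.rep_eq)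

section \<open>Quotients of complex Banach spaces\<close>

lemma scaleC_zero_left [simp]: "0 *\<^sub>C x = 0"
  and scaleC_minus_one [simp]: "(- 1) *\<^sub>C x = - x"
  using scaleC_of_real[of 0 x] scaleC_of_real[of "- 1" x] by simp_all

lemma bounded_linear_scaleC: "bounded_linear (\<lambda>x. a *\<^sub>C x)"
proof (rule bounded_linear_intro)
  show "a *\<^sub>C r *\<^sub>R x = r *\<^sub>R a *\<^sub>C x" for r x
    by (simp add: scaleC_of_real[symmetric] scaleC_scaleC mult.commute)
  show "norm (a *\<^sub>C x) \<le> norm x * cmod a" for x
    by (simp add: norm_scaleC)
qed (rule scaleC_add_right)

lemma scaleC_zero_right [simp]: "a *\<^sub>C 0 = 0"
  and scaleC_minus_right: "a *\<^sub>C (- x) = - (a *\<^sub>C x)"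
  and scaleC_diff_right: "a *\<^sub>C (x - y) = a *\<^sub>C x - a *\<^sub>C y"
  by (simp_all add: linear_simps bounded_linear_scaleC)

text \<open>
  The quotient by a closed complex subspace \<open>K\<close>. The injection \<open>e\<close> only renames vectors, so that
  the cosets can be sets over a prescribed type. All operations are given through representatives,
  and the quotient norm of a coset is the distance of any representative from \<open>K\<close>.
\<close>

locale closed_csubspace =
  fixes K :: "'b::complex_banach set" and e :: "'b \<Rightarrow> 'c"
  assumes closed_K: "closed K"
    and zero_mem: "0 \<in> K"
    and add_mem: "x \<in> K \<Longrightarrow> y \<in> K \<Longrightarrow> x + y \<in> K"
    and scaleC_mem: "x \<in> K \<Longrightarrow> a *\<^sub>C x \<in> K"
    and inj_e: "inj e"
begin

definition coset :: "'b \<Rightarrow> 'c set"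
  where "coset x = e ` {y. y - x \<in> K}"

definition rep :: "'c set \<Rightarrow> 'b"
  where "rep P = (SOME x. coset x = P)"

definition quot :: "'c set cspace"
  where "quot = \<lparr>points = range coset,
    addv = (\<lambda>P Q. coset (rep P + rep Q)), zerov = coset 0,
    scalev = (\<lambda>a P. coset (a *\<^sub>C rep P)), normv = (\<lambda>P. infdist (rep P) K)\<rparr>"

definition induced :: "('b \<Rightarrow> 'b) \<Rightarrow> 'c set \<Rightarrow> 'c set"
  where "induced A P = coset (A (rep P))"

lemma uminus_mem: "x \<in> K \<Longrightarrow> - x \<in> K"
  using scaleC_mem[of x "- 1"] by simp

lemma diff_mem: "x \<in> K \<Longrightarrow> y \<in> K \<Longrightarrow> x - y \<in> K"
  using add_mem[of x "- y"] uminus_mem[of y] by simp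

lemma diff_mem_sym: "x - y \<in> K \<Longrightarrow> y - x \<in> K"
  using uminus_mem[of "x - y"] by simp

lemma diff_mem_trans: "x - y \<in> K \<Longrightarrow> y - z \<in> K \<Longrightarrow> x - z \<in> K"
  using add_mem[of "x - y" "y - z"] by simp

lemma coset_eq_iff: "coset x = coset y \<longleftrightarrow> x - y \<in> K"
proof -
  have "coset x = coset y \<longleftrightarrow> {z. z - x \<in> K} = {z. z - y \<in> K}"
    by (simp add: coset_def inj_image_eq_iff inj_e)
  also have "\<dots> \<longleftrightarrow> x - y \<in> K"
  proof
    assume "{z. z - x \<in> K} = {z. z - y \<in> K}"
    moreover have "x \<in> {z. z - x \<in> K}"
      by (simp add: zero_mem)
    ultimately show "x - y \<in> K" by blast
  qed (use diff_mem_sym diff_mem_trans in blast)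
  finally show ?thesis .
qed

lemma rep_coset: "rep (coset x) - x \<in> K"
  unfolding coset_eq_iff[symmetric] rep_def by (rule someI[of _ x]) simp

lemma infdist_le_norm: "k \<in> K \<Longrightarrow> infdist x K \<le> norm (x - k)"
  using infdist_le[of k K x] by (simp add: dist_norm)

lemma infdist_approx:
  assumes "\<epsilon> > 0"
  obtains k where "k \<in> K" "norm (x - k) < infdist x K + \<epsilon>"
proof -
  have "K \<noteq> {}"
    using zero_mem by auto
  moreover have "(INF k\<in>K. dist x k) < infdist x K + \<epsilon>"
    using \<open>K \<noteq> {}\<close> assms by (simp add: infdist_notempty)
  ultimately obtain k where "k \<in> K" "dist x k < infdist x K + \<epsilon>"
    by (subst (asm) cINF_less_iff) auto
  then show thesis
    using that by (simp add: dist_norm)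
qed

lemma infdist_add_le: "infdist (x + y) K \<le> infdist x K + infdist y K"
proof (rule field_le_epsilon)
  fix \<epsilon> :: real assume "\<epsilon> > 0"
  then obtain k l where k: "k \<in> K" "norm (x - k) < infdist x K + \<epsilon> / 2"
    and l: "l \<in> K" "norm (y - l) < infdist y K + \<epsilon> / 2"
    by (metis half_gt_zero infdist_approx)
  have "infdist (x + y) K \<le> norm ((x - k) + (y - l))"
    using infdist_le_norm[OF add_mem[OF k(1) l(1)], of "x + y"] by (simp add: algebra_simps)
  also have "\<dots> \<le> norm (x - k) + norm (y - l)"
    by (rule norm_triangle_ineq)
  finally show "infdist (x + y) K \<le> infdist x K + infdist y K + \<epsilon>"
    using k l by simp
qed

lemma infdist_mem: "x \<in> K \<Longrightarrow> infdist x K = 0"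
  by simp

lemma infdist_cong: "x - y \<in> K \<Longrightarrow> infdist x K = infdist y K"
  using infdist_add_le[of y "x - y"] infdist_add_le[of x "y - x"] diff_mem_sym[of x y]
  by (simp add: infdist_mem)

text \<open>
  An operator that leaves \<open>K\<close> invariant induces an operator on the quotient whose norm is no larger.
\<close>

lemma infdist_image_le:
  assumes inv: "\<And>k. k \<in> K \<Longrightarrow> A k \<in> K" and A: "bounded_linear A"
    and B: "\<And>y. norm (A y) \<le> B * norm y" and "0 \<le> B"
  shows "infdist (A x) K \<le> B * infdist x K"
proof (rule field_le_epsilon)
  fix \<epsilon> :: real assume "\<epsilon> > 0"
  with \<open>0 \<le> B\<close> have "\<epsilon> / (B + 1) > 0" by simp
  then obtain k where k: "k \<in> K" "norm (x - k) < infdist x K + \<epsilon> / (B + 1)"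
    by (rule infdist_approx)
  have "infdist (A x) K \<le> norm (A x - A k)"
    using inv k by (intro infdist_le_norm) auto
  also have "\<dots> \<le> B * norm (x - k)"
    using B[of "x - k"] A by (simp add: linear_simps)
  also have "\<dots> \<le> B * (infdist x K + \<epsilon> / (B + 1))"
    using k \<open>0 \<le> B\<close> by (intro mult_left_mono) auto
  also have "\<dots> \<le> B * infdist x K + \<epsilon>"
    using \<open>0 \<le> B\<close> \<open>\<epsilon> > 0\<close> by (simp add: field_simps)
  finally show "infdist (A x) K \<le> B * infdist x K + \<epsilon>" .
qed

lemma infdist_scaleC: "infdist (a *\<^sub>C x) K = cmod a * infdist x K"
proof (rule antisym)
  have le: "infdist (b *\<^sub>C y) K \<le> cmod b * infdist y K" for b y
    by (rule infdist_image_le) (auto simp: scaleC_mem bounded_linear_scaleC norm_scaleC)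
  then show "infdist (a *\<^sub>C x) K \<le> cmod a * infdist x K" .
  show "cmod a * infdist x K \<le> infdist (a *\<^sub>C x) K"
  proof (cases "a = 0")
    case False
    then show ?thesis
      using le[of "inverse a" "a *\<^sub>C x"]
      by (simp add: scaleC_scaleC scaleC_one norm_divide field_simps)
  qed (simp add: infdist_nonneg)
qed

lemma infdist_eq_0_iff: "infdist x K = 0 \<longleftrightarrow> x \<in> K"
  using in_closed_iff_infdist_zero[OF closed_K, of x] zero_mem by auto

lemma points_quot [simp]: "points quot = range coset"
  and zerov_quot [simp]: "zerov quot = coset 0"
  by (simp_all add: quot_def)

lemma addv_coset [simp]: "addv quot (coset x) (coset y) = coset (x + y)"
  using add_mem[OF rep_coset[of x] rep_coset[of y]]
  by (simp add: quot_def coset_eq_iff algebra_simps)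

lemma scalev_coset [simp]: "scalev quot a (coset x) = coset (a *\<^sub>C x)"
  using scaleC_mem[OF rep_coset[of x], of a]
  by (simp add: quot_def coset_eq_iff scaleC_diff_right)

lemma normv_coset [simp]: "normv quot (coset x) = infdist x K"
  using infdist_cong[OF rep_coset[of x]] by (simp add: quot_def)

lemma diffv_coset [simp]: "diffv quot (coset x) (coset y) = coset (x - y)"
  by (simp add: diffv_def)

lemma distv_coset [simp]: "distv quot (coset x) (coset y) = infdist (x - y) K"
  by (simp add: distv_def)

sublocale normed_cspace quot
proof
  fix P Q R and a b
  assume P: "P \<in> points quot" and Q: "Q \<in> points quot" and R: "R \<in> points quot"
  from P Q R obtain x y z where [simp]: "P = coset x" "Q = coset y" "R = coset z"
    by auto
  show "addv quot P Q \<in> points quot" "scalev quot a P \<in> points quot"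
    "addv quot (addv quot P Q) R = addv quot P (addv quot Q R)"
    "addv quot P Q = addv quot Q P" "addv quot P (zerov quot) = P"
    by (simp_all add: add_ac)
  have "addv quot P (coset (- x)) = zerov quot"
    by simp
  then show "\<exists>Q\<in>points quot. addv quot P Q = zerov quot"
    by (metis points_quot rangeI)
  show "scalev quot a (addv quot P Q) = addv quot (scalev quot a P) (scalev quot a Q)"
    "scalev quot (a + b) P = addv quot (scalev quot a P) (scalev quot b P)"
    "scalev quot a (scalev quot b P) = scalev quot (a * b) P" "scalev quot 1 P = P"
    by (simp_all add: scaleC_add_right scaleC_add_left scaleC_scaleC scaleC_one)
  show "0 \<le> normv quot P" "normv quot P = 0 \<longleftrightarrow> P = zerov quot"
    "normv quot (addv quot P Q) \<le> normv quot P + normv quot Q"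
    "normv quot (scalev quot a P) = cmod a * normv quot P"
    by (simp_all add: infdist_nonneg infdist_eq_0_iff coset_eq_iff infdist_add_le infdist_scaleC)
qed simp

sublocale banach_cspace quot
proof
  show mcomplete
    unfolding mcomplete_def
  proof (intro allI impI)
    fix \<sigma> assume \<sigma>: "MCauchy \<sigma>"
    then have "range \<sigma> \<subseteq> range coset"
      unfolding MCauchy_def by simp
    then have "\<And>n. \<exists>x. \<sigma> n = coset x"
      by auto
    then obtain x where x: "\<And>n. \<sigma> n = coset (x n)"
      by metis
    \<comment> \<open>Some subsequence has increments of quotient norm less than \<open>(1/2) ^ k\<close>.\<close>
    have "\<exists>N. \<forall>m\<ge>N. \<forall>n\<ge>N. infdist (x m - x n) K < (1/2) ^ k" for k
      using \<sigma> unfolding MCauchy_def by (auto simp: x)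
    then obtain N where N: "\<And>k m n. m \<ge> N k \<Longrightarrow> n \<ge> N k \<Longrightarrow> infdist (x m - x n) K < (1/2) ^ k"
      by metis
    define r where "r = rec_nat (N 0) (\<lambda>k i. max (Suc i) (N (Suc k)))"
    have r_Suc: "r (Suc k) = max (Suc (r k)) (N (Suc k))" for k
      by (simp add: r_def)
    have r_N: "r k \<ge> N k" for k
      by (cases k) (simp_all add: r_def)
    have "strict_mono r"
      by (auto simp: strict_mono_Suc_iff r_Suc)
    have "\<exists>d. d - (x (r (Suc k)) - x (r k)) \<in> K \<and> norm d < (1/2) ^ k" for k
    proof -
      let ?u = "x (r (Suc k)) - x (r k)"
      have "r (Suc k) \<ge> N k" "r k \<ge> N k"
        using r_N[of k] by (auto simp: r_Suc)
      then have "(1/2) ^ k - infdist ?u K > 0"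
        using N by simp
      then obtain l where l: "l \<in> K" "norm (?u - l) < infdist ?u K + ((1/2) ^ k - infdist ?u K)"
        by (rule infdist_approx)
      then show ?thesis
        using uminus_mem[OF l(1)] by (intro exI[of _ "?u - l"]) simp
    qed
    then obtain d where d: "\<And>k. d k - (x (r (Suc k)) - x (r k)) \<in> K"
      and small: "\<And>k. norm (d k) < (1/2) ^ k"
      by metis
    \<comment> \<open>The increments \<open>d\<close> are small in the whole space, so they lift the subsequence to a
      sequence that converges there.\<close>
    have "summable (\<lambda>k. norm (d k))"
      by (rule summable_comparison_test'[of "\<lambda>k. (1/2) ^ k" 0]) (use small less_imp_le in auto)
    then have "summable d"
      by (rule summable_norm_cancel)
    define y where "y k = x (r 0) + (\<Sum>i<k. d i)" for k
    have lim: "y \<longlonglongrightarrow> x (r 0) + suminf d"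
      unfolding y_def by (intro tendsto_intros summable_LIMSEQ \<open>summable d\<close>)
    have y: "y k - x (r k) \<in> K" for k
    proof (induction k)
      case 0
      then show ?case by (simp add: y_def zero_mem)
    next
      case (Suc k)
      then show ?case
        using add_mem[OF Suc d[of k]] by (simp add: y_def algebra_simps)
    qed
    have dist: "distv quot ((\<sigma> \<circ> r) k) (coset (x (r 0) + suminf d))
        \<le> norm (y k - (x (r 0) + suminf d))" for k
    proof -
      have "(\<sigma> \<circ> r) k = coset (y k)"
        using diff_mem_sym[OF y[of k]] by (simp add: x coset_eq_iff)
      then show ?thesis
        using infdist_le_norm[OF zero_mem] by simp
    qed
    have "(\<lambda>k. norm (y k - (x (r 0) + suminf d))) \<longlonglongrightarrow> 0"
      using lim by (simp add: LIM_zero_iff tendsto_norm_zero)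
    then have "(\<lambda>k. distv quot ((\<sigma> \<circ> r) k) (coset (x (r 0) + suminf d))) \<longlonglongrightarrow> 0"
      by (rule tendsto_sandwich[OF always_eventually always_eventually tendsto_const, rotated 2])
        (use dist in auto)
    then have "limitin mtopology (\<sigma> \<circ> r) (coset (x (r 0) + suminf d)) sequentially"
      unfolding limitin_metric_dist_null by (simp add: x)
    then have "limitin mtopology \<sigma> (coset (x (r 0) + suminf d)) sequentially"
      by (rule MCauchy_convergent_subsequence[OF \<sigma> \<open>strict_mono r\<close>])
    then show "\<exists>l. limitin mtopology \<sigma> l sequentially" ..
  qed
qed

lemma induced_coset:
  assumes "bounded_linear A" and "\<And>k. k \<in> K \<Longrightarrow> A k \<in> K"
  shows "induced A (coset x) = coset (A x)"
  using assms(2)[OF rep_coset[of x]] assms(1) by (simp add: induced_def coset_eq_iff linear_simps)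

lemma bounded_op_induced:
  assumes A: "bounded_clinear A" and inv: "\<And>k. k \<in> K \<Longrightarrow> A k \<in> K"
  shows "bounded_op quot (induced A)"
proof -
  have lin: "bounded_linear A"
    using A by (simp add: bounded_clinear_def)
  note [simp] = induced_coset[OF lin inv]
  obtain B where B: "\<And>y. norm (A y) \<le> B * norm y" "0 \<le> B"
    using bounded_linear.nonneg_bounded[OF lin] by (metis mult.commute)
  have "infdist (A x) K \<le> B * infdist x K" for x
    by (rule infdist_image_le[OF inv lin B])
  then show ?thesis
    using A lin by (auto simp: bounded_op_def bounded_clinear_def linear_simps)
qed

lemma opnorm_induced_bound:
  assumes lin: "bounded_linear A" and inv: "\<And>k. k \<in> K \<Longrightarrow> A k \<in> K"
    and B: "\<And>y. norm (A y) \<le> B * norm y" "0 \<le> B"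
  shows "normv quot (induced A (coset x)) / normv quot (coset x) \<le> opnorm quot (induced A)"
    and "opnorm quot (induced A) \<le> B"
proof -
  have bd: "normv quot (induced A P) / normv quot P \<le> B" if "P \<in> points quot" for P
  proof -
    from that obtain x where [simp]: "P = coset x"
      by auto
    show ?thesis
      using infdist_image_le[OF inv lin B, of x] infdist_nonneg[of x K] \<open>0 \<le> B\<close>
      by (simp add: induced_coset[OF lin inv] divide_simps)
  qed
  then show "opnorm quot (induced A) \<le> B"
    unfolding opnorm_def by (intro cSUP_least) auto
  show "normv quot (induced A (coset x)) / normv quot (coset x) \<le> opnorm quot (induced A)"
    unfolding opnorm_def using bd by (intro cSUP_upper bdd_aboveI2) auto
qed

text \<open>
  The group laws and strong continuity hold modulo \<open>K\<close> only, so operators that are not invertible on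
  the large space can induce a group on the quotient.
\<close>

lemma C0_group_induced:
  assumes lin: "\<And>t. bounded_clinear (S t)"
    and inv: "\<And>t k. k \<in> K \<Longrightarrow> S t k \<in> K"
    and zero: "\<And>x. S 0 x - x \<in> K"
    and add: "\<And>s t x. S (s + t) x - S s (S t x) \<in> K"
    and cont: "\<And>x. ((\<lambda>t. infdist (S t x - x) K) \<longlongrightarrow> 0) (at 0)"
  shows "C0_group quot (\<lambda>t. induced (S t))"
proof -
  have [simp]: "induced (S t) (coset x) = coset (S t x)" for t x
    using lin inv by (intro induced_coset) (auto simp: bounded_clinear_def)
  show ?thesis
    using zero add cont bounded_op_induced[OF lin inv]
    by (auto simp: C0_group_def coset_eq_iff)
qed

end

section \<open>Operators on absolutely summable sequences\<close>

lemma bounded_clinear_imp_bounded_linear: "bounded_clinear A \<Longrightarrow> bounded_linear A"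
  by (simp add: bounded_clinear_def)

lemma bounded_clinear_compose:
  "bounded_clinear A \<Longrightarrow> bounded_clinear B \<Longrightarrow> bounded_clinear (\<lambda>x. A (B x))"
  using bounded_linear_compose[of A B] by (simp add: bounded_clinear_def)

lemma bounded_clinear_scaleR: "bounded_clinear A \<Longrightarrow> bounded_clinear (\<lambda>x. r *\<^sub>R A x)"
  using bounded_linear_const_scaleR[of A r]
  by (simp add: bounded_clinear_def scaleC_of_real[symmetric] scaleC_scaleC mult.commute)

definition map_ell1 :: "('a \<Rightarrow> 'a) \<Rightarrow> 'a ell1 \<Rightarrow> 'a::real_normed_vector ell1"
  where "map_ell1 A f = Ell1 (\<lambda>n. A (coord f n))"

text \<open>
  The operator \<open>A\<close> may act on all coordinates at once because a bound on \<open>A\<close> keeps the sequence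
  absolutely summable.
\<close>

lemma
  fixes A :: "'a \<Rightarrow> 'a::real_normed_vector"
  assumes "\<And>x. norm (A x) \<le> B * norm x" "0 \<le> B"
  shows coord_map_ell1_bound: "coord (map_ell1 A f) n = A (coord f n)"
    and norm_map_ell1_le: "norm (map_ell1 A f) \<le> B * norm f"
proof -
  have "(\<Sum>n<N. norm (A (coord f n))) \<le> B * norm f" for N
  proof -
    have "(\<Sum>n<N. norm (A (coord f n))) \<le> (\<Sum>n<N. B * norm (coord f n))"
      using assms by (intro sum_mono) auto
    also have "\<dots> \<le> B * norm f"
      using assms(2) by (simp add: sum_distrib_left[symmetric] mult_left_mono sum_norm_coord_le)
    finally show ?thesis .
  qed
  from Ell1_norm_leI[OF this]
  show "coord (map_ell1 A f) n = A (coord f n)" "norm (map_ell1 A f) \<le> B * norm f"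
    by (simp_all add: map_ell1_def)
qed

lemma coord_map_ell1: "bounded_linear A \<Longrightarrow> coord (map_ell1 A f) n = A (coord f n)"
  using bounded_linear.nonneg_bounded[of A] by (metis coord_map_ell1_bound mult.commute)

lemma bounded_clinear_map_ell1:
  assumes A: "bounded_clinear A"
  shows "bounded_clinear (map_ell1 A)"
proof -
  have lin: "bounded_linear A"
    using A by (rule bounded_clinear_imp_bounded_linear)
  note [simp] = coord_map_ell1[OF lin]
  have "bounded_linear (map_ell1 A)"
  proof (rule bounded_linear_intro)
    show "map_ell1 A (f + g) = map_ell1 A f + map_ell1 A g" for f g
      using lin by (intro ell1_eqI) (simp add: linear_simps)
    show "map_ell1 A (r *\<^sub>R f) = r *\<^sub>R map_ell1 A f" for r f
      using lin by (intro ell1_eqI) (simp add: linear_simps)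
    show "norm (map_ell1 A f) \<le> norm f * onorm A" for f
      using norm_map_ell1_le[of A "onorm A" f] onorm[OF lin] onorm_pos_le[OF lin]
      by (simp add: mult.commute)
  qed
  moreover have "map_ell1 A (a *\<^sub>C f) = a *\<^sub>C map_ell1 A f" for a f
    using A by (intro ell1_eqI) (simp add: bounded_clinear_def)
  ultimately show ?thesis
    by (simp add: bounded_clinear_def)
qed

lift_definition shift :: "'a::real_normed_vector ell1 \<Rightarrow> 'a ell1"
  is "\<lambda>f n. case n of 0 \<Rightarrow> 0 | Suc m \<Rightarrow> f m"
  by (subst summable_Suc_iff[symmetric]) simp

lift_definition delta :: "'a::real_normed_vector \<Rightarrow> 'a ell1" is "\<lambda>x n. if n = 0 then x else 0"
  by (subst summable_Suc_iff[symmetric]) simp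

lemma coord_shift [simp]: "coord (shift f) 0 = 0" "coord (shift f) (Suc n) = coord f n"
  by (simp_all add: shift.rep_eq)

lemma coord_delta: "coord (delta x) n = (if n = 0 then x else 0)"
  by (simp add: delta.rep_eq)

lemma norm_shift [simp]: "norm (shift f) = norm f"
  using suminf_split_head[OF summable_norm_coord, of "shift f"] by (simp add: norm_ell1.rep_eq)

lemma norm_delta [simp]: "norm (delta x) = norm x"
  using suminf_split_head[OF summable_norm_coord, of "delta x"]
  by (simp add: norm_ell1.rep_eq coord_delta)

lemma bounded_clinear_shift: "bounded_clinear shift"
proof -
  have "shift (f + g) = shift f + shift g" "shift (r *\<^sub>R f) = r *\<^sub>R shift f"
    "shift (a *\<^sub>C f) = a *\<^sub>C shift f" for f g :: "'a ell1" and r a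
    by (rule ell1_eqI; simp add: shift.rep_eq split: nat.split)+
  then show ?thesis
    by (auto simp: bounded_clinear_def intro!: bounded_linear_intro[of _ 1])
qed

lemma map_ell1_shift: "bounded_linear A \<Longrightarrow> map_ell1 A (shift f) = shift (map_ell1 A f)"
  by (rule ell1_eqI) (simp add: coord_map_ell1 shift.rep_eq linear_simps split: nat.split)

text \<open>
  Strong convergence passes to sequences by dominated convergence for series.
\<close>

lemma map_ell1_tendsto:
  fixes A :: "real \<Rightarrow> 'a \<Rightarrow> 'a::real_normed_vector"
  assumes F: "F \<noteq> bot"
    and lim: "\<And>x. ((\<lambda>t. A t x) \<longlongrightarrow> x) F"
    and bound: "\<forall>\<^sub>F t in F. \<forall>x. norm (A t x) \<le> B * norm x" and "0 \<le> B"
  shows "((\<lambda>t. norm (map_ell1 (A t) f - f)) \<longlongrightarrow> 0) F"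
proof -
  have "((\<lambda>t. \<Sum>n. norm (A t (coord f n) - coord f n)) \<longlongrightarrow> (\<Sum>n. 0)) F"
  proof (rule conjunct2[OF conjunct2[OF tannerys_theorem]])
    show "((\<lambda>t. norm (A t (coord f n) - coord f n)) \<longlongrightarrow> 0) F" for n
      using lim by (intro tendsto_norm_zero LIM_zero)
    show "summable (\<lambda>n. (B + 1) * norm (coord f n))"
      by (intro summable_mult summable_norm_coord)
    have "\<forall>\<^sub>F t in F. \<forall>n. norm (norm (A t (coord f n) - coord f n)) \<le> (B + 1) * norm (coord f n)"
      using bound
    proof eventually_elim
      case (elim t)
      then show ?case
        by (auto simp: distrib_right intro!: order_trans[OF norm_triangle_ineq4] add_right_mono)
    qed
    then have "\<forall>\<^sub>F t in F. \<forall>n\<ge>0. norm (norm (A t (coord f n) - coord f n))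
        \<le> (B + 1) * norm (coord f n)"
      by simp
    then show "\<forall>\<^sub>F (n, t) in at_top \<times>\<^sub>F F.
        norm (norm (A t (coord f n) - coord f n)) \<le> (B + 1) * norm (coord f n)"
      unfolding eventually_prod_filter
      by (intro exI[of _ "\<lambda>_. True"] exI[of _ "\<lambda>t. \<forall>n. norm (norm (A t (coord f n) - coord f n))
        \<le> (B + 1) * norm (coord f n)"]) auto
  qed (rule F)
  moreover have "\<forall>\<^sub>F t in F. (\<Sum>n. norm (A t (coord f n) - coord f n)) = norm (map_ell1 (A t) f - f)"
    using bound
  proof eventually_elim
    case (elim t)
    then show ?case
      using coord_map_ell1_bound[of "A t" B f] \<open>0 \<le> B\<close> by (simp add: norm_ell1.rep_eq)
  qed
  ultimately show ?thesis
    by (simp add: tendsto_cong)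
qed

section \<open>The extension of an expanding semigroup\<close>

text \<open>
  A lower bound at the single time \<open>\<tau>\<close> with constant \<open>exp (- \<omega> \<tau>)\<close>. It says that the operator
  \<open>U\<close> below does not decrease norms.
\<close>

locale expanding_semigroup =
  fixes T :: "real \<Rightarrow> 'a::complex_banach \<Rightarrow> 'a" and \<omega> \<tau> :: real
  assumes T: "C0_semigroup T" and \<tau>: "\<tau> > 0"
    and expanding: "norm x \<le> exp (\<omega> * \<tau>) * norm (T \<tau> x)"
begin

definition U :: "'a \<Rightarrow> 'a"
  where "U x = exp (\<omega> * \<tau>) *\<^sub>R T \<tau> x"

text \<open>
  A sequence \<open>f\<close> stands for the formal series of the vectors \<open>U\<^sup>-\<^sup>n (f n)\<close> in the extension space.
  In this reading \<open>shift\<close> is the inverse of \<open>U\<close>, so the sequences \<open>R d\<close> have to represent 0.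
\<close>

definition R :: "'a ell1 \<Rightarrow> 'a ell1"
  where "R d = map_ell1 U (shift d) - d"

definition K :: "'a ell1 set"
  where "K = closure (range R)"

text \<open>
  The representative of the extended semigroup at time \<open>s - n \<tau>\<close>, where \<open>s \<ge> 0\<close>: the factor
  \<open>exp (\<omega> \<tau> n)\<close> turns the \<open>n\<close>-th power of the inverse of \<open>U\<close> into that of the inverse of \<open>T \<tau>\<close>.
\<close>

definition G :: "nat \<Rightarrow> real \<Rightarrow> 'a ell1 \<Rightarrow> 'a ell1"
  where "G n s f = exp (\<omega> * \<tau> * real n) *\<^sub>R (shift ^^ n) (map_ell1 (T s) f)"

lemma clinear_T: "s \<ge> 0 \<Longrightarrow> bounded_clinear (T s)"
  using T by (rule C0_semigroup_bounded_clinear)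

lemma linear_T: "s \<ge> 0 \<Longrightarrow> bounded_linear (T s)"
  using clinear_T by (rule bounded_clinear_imp_bounded_linear)

lemma clinear_U: "bounded_clinear U"
  unfolding U_def using clinear_T \<tau> by (intro bounded_clinear_scaleR) simp

lemma linear_U: "bounded_linear U"
  using clinear_U by (rule bounded_clinear_imp_bounded_linear)

lemma clinear_shift_power: "bounded_clinear (shift ^^ n :: 'a ell1 \<Rightarrow> 'a ell1)"
proof (induction n)
  case 0
  then show ?case by (simp add: bounded_clinear_def id_def)
next
  case (Suc n)
  then show ?case
    using bounded_clinear_compose[OF bounded_clinear_shift] by (simp add: o_def)
qed

lemma clinear_G: "s \<ge> 0 \<Longrightarrow> bounded_clinear (G n s)"
  unfolding G_def
  by (intro bounded_clinear_scaleR bounded_clinear_compose[OF clinear_shift_power]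
      bounded_clinear_map_ell1 clinear_T)

lemma linear_R: "bounded_linear R"
  unfolding R_def
  by (intro bounded_linear_sub bounded_linear_ident bounded_clinear_imp_bounded_linear
      bounded_clinear_compose[OF bounded_clinear_map_ell1[OF clinear_U] bounded_clinear_shift])

lemma R_scaleC: "R (a *\<^sub>C d) = a *\<^sub>C R d"
  using bounded_clinear_map_ell1[OF clinear_U] bounded_clinear_shift[where ?'a='a]
  by (simp add: R_def bounded_clinear_def scaleC_diff_right)

lemma R_mem: "R d \<in> K"
  unfolding K_def by (rule subsetD[OF closure_subset]) simp

text \<open>
  Whatever commutes with \<open>R\<close> leaves \<open>K\<close> invariant and so descends to the quotient. This applies to
  \<open>shift\<close>, to \<open>T s\<close> acting on each coordinate, and to scalars.
\<close>

lemma mem_K_if_commutes: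
  assumes "bounded_linear A" and "\<And>d. A (R d) = R (A d)" and "k \<in> K"
  shows "A k \<in> K"
proof -
  have "A ` K \<subseteq> closure (A ` range R)"
    unfolding K_def using assms(1) by (rule closure_bounded_linear_image_subset)
  also have "\<dots> \<subseteq> K"
    unfolding K_def using assms(2) by (intro closure_mono) auto
  finally show ?thesis
    using assms(3) by blast
qed

definition encode :: "'a ell1 \<Rightarrow> real \<Rightarrow> 'a"
  where "encode f r = coord f (nat \<lfloor>r\<rfloor>)"

lemma inj_encode: "inj encode"
proof (rule injI)
  fix f g assume "encode f = encode g"
  then have "encode f (real n) = encode g (real n)" for n
    by simp
  then show "f = g"
    by (intro ell1_eqI) (simp add: encode_def)
qed

sublocale closed_csubspace K encode
proof
  show "closed K" by (simp add: K_def)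
  show "0 \<in> K"
    using R_mem[of 0] linear_R by (simp add: linear_simps)
  show "x + y \<in> K" if "x \<in> K" "y \<in> K" for x y
  proof -
    from that obtain d e where "\<forall>n. d n \<in> range R" "d \<longlonglongrightarrow> x" "\<forall>n. e n \<in> range R" "e \<longlonglongrightarrow> y"
      unfolding K_def closure_sequential by (elim exE conjE)
    moreover have "u + v \<in> range R" if "u \<in> range R" "v \<in> range R" for u v
      using that by (auto simp: linear_simps(1)[OF linear_R, symmetric])
    ultimately show ?thesis
      unfolding K_def closure_sequential
      by (intro exI[of _ "\<lambda>n. d n + e n"]) (auto intro: tendsto_add)
  qed
  show "a *\<^sub>C x \<in> K" if "x \<in> K" for a x
    using that by (rule mem_K_if_commutes[OF bounded_linear_scaleC, rotated]) (simp add: R_scaleC)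
qed (rule inj_encode)

lemma shift_R: "shift (R d) = R (shift d)"
proof -
  have "bounded_linear (shift :: 'a ell1 \<Rightarrow> 'a ell1)"
    by (intro bounded_clinear_imp_bounded_linear bounded_clinear_shift)
  then show ?thesis
    by (simp add: R_def map_ell1_shift[OF linear_U] linear_simps)
qed

lemma shift_power_R: "(shift ^^ n) (R d) = R ((shift ^^ n) d)"
  by (induction n) (simp_all add: shift_R)

lemma map_ell1_shift_power:
  "s \<ge> 0 \<Longrightarrow> map_ell1 (T s) ((shift ^^ n) f) = (shift ^^ n) (map_ell1 (T s) f)"
  by (induction n) (simp_all add: map_ell1_shift linear_T)

lemma T_add: "s \<ge> 0 \<Longrightarrow> t \<ge> 0 \<Longrightarrow> T s (T t x) = T (s + t) x"
  using C0_semigroup_add[OF T] by simp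

lemma map_ell1_T_add:
  "s \<ge> 0 \<Longrightarrow> t \<ge> 0 \<Longrightarrow> map_ell1 (T s) (map_ell1 (T t) f) = map_ell1 (T (s + t)) f"
  by (rule ell1_eqI) (simp add: coord_map_ell1 linear_T T_add)

lemma map_ell1_U: "map_ell1 U f = exp (\<omega> * \<tau>) *\<^sub>R map_ell1 (T \<tau>) f"
  using \<tau> by (intro ell1_eqI) (simp add: coord_map_ell1 linear_U linear_T, simp add: U_def)

lemma map_ell1_R:
  assumes "s \<ge> 0"
  shows "map_ell1 (T s) (R d) = R (map_ell1 (T s) d)"
  using assms \<tau> bounded_clinear_imp_bounded_linear[OF bounded_clinear_map_ell1[OF clinear_T[OF assms]]]
  by (simp add: R_def map_ell1_U linear_simps map_ell1_T_add add.commute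
      map_ell1_shift[symmetric] linear_T)

lemma G_R: "s \<ge> 0 \<Longrightarrow> G n s (R d) = R (G n s d)"
  using linear_R by (simp add: G_def map_ell1_R shift_power_R linear_simps)

lemma G_mem: "s \<ge> 0 \<Longrightarrow> k \<in> K \<Longrightarrow> G n s k \<in> K"
  by (rule mem_K_if_commutes) (simp_all add: G_R bounded_clinear_imp_bounded_linear clinear_G)

lemma G_compose:
  assumes "s \<ge> 0" "t \<ge> 0"
  shows "G m s (G n t f) = G (m + n) (s + t) f"
  using assms bounded_clinear_imp_bounded_linear[OF clinear_shift_power, of m]
    bounded_clinear_imp_bounded_linear[OF bounded_clinear_map_ell1[OF clinear_T[OF assms(1)]]]
  by (simp add: G_def linear_simps map_ell1_shift_power map_ell1_T_add funpow_add
      exp_add[symmetric] algebra_simps)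

lemma G_zero: "G 0 0 f = f"
  using C0_semigroup_zero[OF T]
  by (intro ell1_eqI) (simp add: G_def coord_map_ell1 linear_T)

text \<open>
  On the quotient \<open>U\<close> and \<open>shift\<close> are inverse to each other, so one more step back by \<open>\<tau>\<close> cancels one
  more step forward. Consequently \<open>G n s\<close> depends only on \<open>s - n \<tau>\<close> modulo \<open>K\<close>.
\<close>

lemma G_step: "s \<ge> 0 \<Longrightarrow> G (Suc n) (s + \<tau>) f - G n s f \<in> K"
proof -
  assume s: "s \<ge> 0"
  have "map_ell1 U (shift g) = G 1 \<tau> g" for g
    using \<tau> by (simp add: G_def map_ell1_U map_ell1_shift linear_T)
  then have "R (G n s f) = G (Suc n) (s + \<tau>) f - G n s f"
    using s \<tau> by (simp add: R_def G_compose add.commute)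
  then show ?thesis
    using R_mem by metis
qed

lemma G_steps: "s \<ge> 0 \<Longrightarrow> G (n + m) (s + real m * \<tau>) f - G n s f \<in> K"
proof (induction m)
  case 0
  then show ?case by (simp add: zero_mem)
next
  case (Suc m)
  have "G (Suc (n + m)) (s + real m * \<tau> + \<tau>) f - G (n + m) (s + real m * \<tau>) f \<in> K"
    using Suc.prems \<tau> by (intro G_step) simp
  then show ?case
    using diff_mem_trans Suc by (auto simp: algebra_simps)
qed

lemma G_cong:
  assumes "s \<ge> 0" "t \<ge> 0" and eq: "s - real m * \<tau> = t - real n * \<tau>"
  shows "G m s f - G n t f \<in> K"
proof -
  have *: "G n t f - G m s f \<in> K" if "m \<le> n" "s \<ge> 0" "s - real m * \<tau> = t - real n * \<tau>" for m n s t
    using G_steps[of s m "n - m" f] that by (simp add: of_nat_diff algebra_simps)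
  show ?thesis
    using *[of m n s t] *[of n m t s] assms diff_mem_sym by (cases "m \<le> n") auto
qed

text \<open>
  The least number of steps of length \<open>\<tau>\<close> back from which time \<open>t\<close> is reached going forward. For
  \<open>t \<ge> 0\<close> it is 0, and then \<open>S t\<close> does not involve \<open>shift\<close>.
\<close>

definition steps :: "real \<Rightarrow> nat"
  where "steps t = nat \<lceil>- t / \<tau>\<rceil>"

definition S :: "real \<Rightarrow> 'a ell1 \<Rightarrow> 'a ell1"
  where "S t = G (steps t) (real (steps t) * \<tau> + t)"

lemma steps_nonneg: "real (steps t) * \<tau> + t \<ge> 0"
proof -
  have "- t / \<tau> \<le> real (steps t)"
    unfolding steps_def by (rule real_nat_ceiling_ge)
  then show ?thesis
    using \<tau> by (simp add: field_simps)
qed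

lemma steps_le: "t \<le> 0 \<Longrightarrow> real (steps t) * \<tau> + t \<le> \<tau>"
proof -
  assume "t \<le> 0"
  then have "- t / \<tau> \<ge> 0"
    using \<tau> by (simp add: divide_nonpos_pos)
  then have "real (steps t) \<le> - t / \<tau> + 1"
    unfolding steps_def by linarith
  then show ?thesis
    using \<tau> by (simp add: field_simps)
qed

lemma steps_pos: "t \<ge> 0 \<Longrightarrow> steps t = 0"
  using \<tau> by (simp add: steps_def)

lemma S_nonneg: "t \<ge> 0 \<Longrightarrow> S t = map_ell1 (T t)"
  by (simp add: S_def steps_pos G_def fun_eq_iff)

lemma clinear_S: "bounded_clinear (S t)"
  unfolding S_def using steps_nonneg by (rule clinear_G)

lemma linear_S: "bounded_linear (S t)"
  using clinear_S by (rule bounded_clinear_imp_bounded_linear)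

lemma S_mem: "k \<in> K \<Longrightarrow> S t k \<in> K"
  unfolding S_def using steps_nonneg by (rule G_mem)

lemma S_add: "S (s + t) f - S s (S t f) \<in> K"
  unfolding S_def G_compose[OF steps_nonneg steps_nonneg]
  by (rule G_cong[OF steps_nonneg add_nonneg_nonneg[OF steps_nonneg steps_nonneg]])
    (simp add: algebra_simps)

lemma S_zero: "S 0 f = f"
  using G_zero by (simp add: S_def steps_pos)

text \<open>
  Since \<open>T t\<close> acts on each coordinate, its norm on sequences is not worse than on the original
  space: the bound has constant 1.
\<close>

lemma norm_S_pos: "t \<ge> 0 \<Longrightarrow> norm (S t f) \<le> onorm (T t) * norm f"
  unfolding S_nonneg by (rule norm_map_ell1_le) (simp_all add: onorm onorm_pos_le linear_T)

lemma norm_shift_power [simp]: "norm ((shift ^^ n) f) = norm f"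
  by (induction n) simp_all

text \<open>
  Because \<open>shift\<close> is isometric, \<open>n\<close> steps back cost exactly \<open>exp (\<omega> \<tau> n)\<close>. The remaining forward
  time \<open>n \<tau> - t\<close> lies in \<open>[0, \<tau>]\<close>, where \<open>T\<close> is bounded; this and the difference between \<open>\<omega> \<tau> n\<close>
  and \<open>\<omega> t\<close> (of either sign) go into the constant \<open>M\<close>.
\<close>

lemma norm_S_neg: "\<exists>M\<ge>1. \<forall>t\<ge>0. \<forall>f. norm (S (- t) f) \<le> M * exp (\<omega> * t) * norm f"
proof -
  obtain B where B: "B \<ge> 1" "\<And>t x. t \<in> {0..\<tau>} \<Longrightarrow> norm (T t x) \<le> B * norm x"
    using C0_semigroup_bounded_on_compact[OF T] by blast
  define M where "M = B * exp (\<bar>\<omega>\<bar> * \<tau>)"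
  have "norm (S (- t) f) \<le> M * exp (\<omega> * t) * norm f" if "t \<ge> 0" for t f
  proof -
    define n where "n = steps (- t)"
    define s where "s = real n * \<tau> - t"
    have s: "s \<in> {0..\<tau>}"
      using steps_nonneg[of "- t"] steps_le[of "- t"] that by (simp add: s_def n_def)
    have "\<omega> * s \<le> \<bar>\<omega>\<bar> * \<tau>"
      using s by (intro mult_mono) auto
    then have e: "exp (\<omega> * \<tau> * real n) \<le> exp (\<bar>\<omega>\<bar> * \<tau>) * exp (\<omega> * t)"
      by (simp add: s_def exp_add[symmetric] algebra_simps)
    have "norm (S (- t) f) = exp (\<omega> * \<tau> * real n) * norm (map_ell1 (T s) f)"
      by (simp add: S_def G_def s_def n_def)
    also have "\<dots> \<le> exp (\<bar>\<omega>\<bar> * \<tau>) * exp (\<omega> * t) * (B * norm f)"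
      using e B s by (intro mult_mono norm_map_ell1_le) auto
    finally show ?thesis
      by (simp add: M_def mult_ac)
  qed
  moreover have "M \<ge> 1"
    unfolding M_def using B(1) \<tau> by (intro mult_ge1_I) simp_all
  ultimately show ?thesis by blast
qed

lemma S_tendsto_right: "((\<lambda>t. norm (f - S t f)) \<longlongrightarrow> 0) (at_right 0)"
proof -
  obtain B where B: "B \<ge> 1" "\<And>t x. t \<in> {0..1} \<Longrightarrow> norm (T t x) \<le> B * norm x"
    using C0_semigroup_bounded_on_compact[OF T] by blast
  have "\<forall>\<^sub>F t in at_right 0. t \<in> {0<..<1::real}"
    by (rule eventually_at_right_real) simp
  then have "\<forall>\<^sub>F t in at_right 0. \<forall>x. norm (T t x) \<le> B * norm x"
    by eventually_elim (use B in auto)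
  then have "((\<lambda>t. norm (map_ell1 (T t) f - f)) \<longlongrightarrow> 0) (at_right 0)"
    using B(1) by (intro map_ell1_tendsto C0_semigroup_tendsto[OF T]) auto
  moreover have "\<forall>\<^sub>F t in at_right 0. norm (f - S t f) = norm (map_ell1 (T t) f - f)"
    by (auto simp: eventually_at_filter S_nonneg norm_minus_commute)
  ultimately show ?thesis
    by (simp add: tendsto_cong)
qed

text \<open>
  From the left, \<open>S (- t) f - f\<close> equals \<open>S (- t) (f - S t f)\<close> modulo \<open>K\<close>, and the operators \<open>S (- t)\<close>
  are bounded uniformly for small \<open>t\<close>; so convergence from the right suffices.
\<close>

lemma S_tendsto: "((\<lambda>t. infdist (S t f - f) K) \<longlongrightarrow> 0) (at 0)"
proof (rule filterlim_split_at)
  have "infdist (S t f - f) K \<le> norm (f - S t f)" for t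
    using infdist_le_norm[OF zero_mem, of "S t f - f"] by (simp add: norm_minus_commute)
  then show "((\<lambda>t. infdist (S t f - f) K) \<longlongrightarrow> 0) (at_right 0)"
    by (intro tendsto_sandwich[OF _ _ tendsto_const S_tendsto_right[of f]]) (auto simp: infdist_nonneg)
  obtain M where M: "M \<ge> 1" "\<And>t f. t \<ge> 0 \<Longrightarrow> norm (S (- t) f) \<le> M * exp (\<omega> * t) * norm f"
    using norm_S_neg by blast
  have bound: "infdist (S (- t) f - f) K \<le> M * exp (\<omega> * t) * norm (f - S t f)" if "t > 0" for t
  proof -
    have "S (- t) (f - S t f) - (S (- t) f - f) \<in> K"
      using S_add[of "- t" t f] linear_S by (simp add: linear_simps S_zero)
    then have "infdist (S (- t) f - f) K = infdist (S (- t) (f - S t f)) K"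
      using infdist_cong by metis
    also have "\<dots> \<le> norm (S (- t) (f - S t f))"
      using infdist_le_norm[OF zero_mem] by simp
    also have "\<dots> \<le> M * exp (\<omega> * t) * norm (f - S t f)"
      using that by (intro M) simp
    finally show ?thesis .
  qed
  have "((\<lambda>t. M * exp (\<omega> * t) * norm (f - S t f)) \<longlongrightarrow> M * exp (\<omega> * 0) * 0) (at_right 0)"
    by (intro tendsto_intros S_tendsto_right)
  then have "((\<lambda>t. M * exp (\<omega> * t) * norm (f - S t f)) \<longlongrightarrow> 0) (at_right 0)"
    by simp
  then have "((\<lambda>t. infdist (S (- t) f - f) K) \<longlongrightarrow> 0) (at_right 0)"
    by (rule tendsto_sandwich[OF _ _ tendsto_const, rotated 2])
      (auto simp: infdist_nonneg eventually_at_filter bound)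
  then show "((\<lambda>t. infdist (S t f - f) K) \<longlongrightarrow> 0) (at_left 0)"
    by (simp add: filterlim_at_left_to_right)
qed

text \<open>
  The heart of the isometry. The coordinates of \<open>delta x - R d\<close> are \<open>x + d 0\<close> and
  \<open>d (Suc n) - U (d n)\<close>. As \<open>U\<close> does not decrease norms, the latter have norm at least
  \<open>norm (d n) - norm (d (Suc n))\<close>, and the sum of these bounds telescopes; the remainder
  \<open>norm (d n)\<close> tends to 0.
\<close>

lemma norm_delta_minus_R: "norm x \<le> norm (delta x - R d)"
proof -
  let ?g = "delta x - R d"
  have g0: "coord ?g 0 = x + coord d 0"
    using linear_U by (simp add: R_def coord_delta coord_map_ell1 linear_simps)
  have gSuc: "coord ?g (Suc n) = coord d (Suc n) - U (coord d n)" for n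
    using linear_U by (simp add: R_def coord_delta coord_map_ell1)
  have "norm x - norm (coord d n) \<le> (\<Sum>i<Suc n. norm (coord ?g i))" for n
  proof (induction n)
    case 0
    show ?case
      using norm_triangle_ineq4[of "x + coord d 0" "coord d 0"] g0 by simp
  next
    case (Suc n)
    have "norm (coord d n) \<le> norm (U (coord d n))"
      using expanding by (simp add: U_def)
    also have "\<dots> \<le> norm (coord ?g (Suc n)) + norm (coord d (Suc n))"
      unfolding gSuc using norm_triangle_ineq2[of "U (coord d n)" "coord d (Suc n)"]
      by (simp add: norm_minus_commute)
    finally show ?case
      using Suc by simp
  qed
  then have "norm x - norm (coord d n) \<le> norm ?g" for n
    using sum_norm_coord_le[of "{..<Suc n}" ?g] by (meson finite_lessThan order_trans)
  moreover have "(\<lambda>n. norm x - norm (coord d n)) \<longlonglongrightarrow> norm x - 0"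
    by (intro tendsto_intros summable_LIMSEQ_zero summable_norm_coord)
  ultimately show ?thesis
    by (intro LIMSEQ_le_const2) auto
qed

text \<open>
  The lower bound extends by continuity from the range of \<open>R\<close> to its closure \<open>K\<close>; the upper bound is
  the distance to 0.
\<close>

lemma infdist_delta: "infdist (delta x) K = norm x"
proof (rule antisym)
  show "infdist (delta x) K \<le> norm x"
    using infdist_le_norm[OF zero_mem, of "delta x"] by simp
  have "K \<subseteq> {k. norm x \<le> norm (delta x - k)}"
    unfolding K_def using norm_delta_minus_R
    by (intro closure_minimal closed_Collect_le continuous_intros) auto
  moreover have "K \<noteq> {}"
    using zero_mem by auto
  ultimately show "norm x \<le> infdist (delta x) K"
    unfolding infdist_notempty[OF \<open>K \<noteq> {}\<close>] by (intro cINF_greatest) (auto simp: dist_norm)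
qed

lemma isometric_embedding_delta: "isometric_embedding quot (\<lambda>x. coset (delta x))"
proof -
  have "delta (x + y) = delta x + delta y" "delta (a *\<^sub>C x) = a *\<^sub>C delta x" for x y :: 'a and a
    by (rule ell1_eqI; simp add: coord_delta)+
  then show ?thesis
    by (simp add: isometric_embedding_def infdist_delta)
qed

lemma induced_S_coset: "induced (S t) (coset f) = coset (S t f)"
  using linear_S S_mem by (rule induced_coset)

lemma S_delta: "t \<ge> 0 \<Longrightarrow> S t (delta x) = delta (T t x)"
  using linear_T[of t]
  by (intro ell1_eqI) (simp add: S_nonneg coord_map_ell1 coord_delta linear_simps)

lemma C0_group_extension_induced:
  "C0_group_extension T quot (\<lambda>x. coset (delta x)) (\<lambda>t. induced (S t))"
proof -
  have "C0_group quot (\<lambda>t. induced (S t))"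
    by (rule C0_group_induced) (simp_all add: clinear_S S_mem S_zero zero_mem S_add S_tendsto)
  then show ?thesis
    by (auto simp: C0_group_extension_def induced_S_coset S_delta)
qed

lemma opnorm_induced_S_pos:
  assumes "t \<ge> 0"
  shows "opnorm quot (induced (S t)) = onorm (T t)"
proof (rule antisym)
  note bound = opnorm_induced_bound[OF linear_S S_mem norm_S_pos[OF assms] onorm_pos_le[OF linear_T[OF assms]]]
  show "opnorm quot (induced (S t)) \<le> onorm (T t)"
    by (rule bound)
  have "norm (T t x) / norm x \<le> opnorm quot (induced (S t))" for x
    using bound(1)[of "delta x"] assms by (simp add: induced_S_coset S_delta infdist_delta)
  then show "onorm (T t) \<le> opnorm quot (induced (S t))"
    unfolding onorm_def by (intro cSUP_least) auto
qed

lemma opnorm_induced_S_neg: "\<exists>M\<ge>1. \<forall>t\<ge>0. opnorm quot (induced (S (- t))) \<le> M * exp (\<omega> * t)"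
proof -
  obtain M where M: "M \<ge> 1" "\<And>t f. t \<ge> 0 \<Longrightarrow> norm (S (- t) f) \<le> M * exp (\<omega> * t) * norm f"
    using norm_S_neg by blast
  then have "opnorm quot (induced (S (- t))) \<le> M * exp (\<omega> * t)" if "t \<ge> 0" for t
    using that by (intro opnorm_induced_bound(2) linear_S S_mem) auto
  with M show ?thesis by blast
qed

end

theorem proposition5p3:
  fixes T :: "real \<Rightarrow> 'a::complex_banach \<Rightarrow> 'a"
    and c \<alpha> \<omega> :: real
  assumes "C0_semigroup T"
    and "lower_bounds T"
    and "c > 0"
    and "\<And>x t. t > 0 \<Longrightarrow> norm (T t x) \<ge> c * exp (- \<alpha> * t) * norm x"
    and "\<omega> > \<alpha>"
  shows "\<exists>(Y :: 'a ext_point cspace) (J :: 'a \<Rightarrow> 'a ext_point)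
            (S :: real \<Rightarrow> 'a ext_point \<Rightarrow> 'a ext_point) (M :: real).
           banach_cspace Y \<and> isometric_embedding Y J \<and> C0_group_extension T Y J S \<and> M \<ge> 1 \<and>
           (\<forall>t>0. opnorm Y (S t) = onorm (T t) \<and> opnorm Y (S (- t)) \<le> M * exp (\<omega> * t))"
proof -
  \<comment> \<open>The gap between \<open>\<alpha>\<close> and \<open>\<omega>\<close> absorbs the constant \<open>c\<close> once the time step is this long.\<close>
  define \<tau> where "\<tau> = max 1 (- ln c / (\<omega> - \<alpha>))"
  have "\<tau> > 0"
    by (simp add: \<tau>_def)
  have "- ln c / (\<omega> - \<alpha>) \<le> \<tau>"
    by (simp add: \<tau>_def)
  then have "- ln c \<le> (\<omega> - \<alpha>) * \<tau>"
    using \<open>\<omega> > \<alpha>\<close> by (simp add: field_simps)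
  then have "1 \<le> exp (ln c + (\<omega> - \<alpha>) * \<tau>)"
    by simp
  also have "\<dots> = exp (\<omega> * \<tau>) * (exp (ln c) * exp (- \<alpha> * \<tau>))"
    by (simp only: exp_add[symmetric]) (simp add: algebra_simps)
  also have "exp (ln c) = c"
    using \<open>c > 0\<close> by simp
  finally have ge1: "1 \<le> exp (\<omega> * \<tau>) * (c * exp (- \<alpha> * \<tau>))" .
  have "norm x \<le> exp (\<omega> * \<tau>) * norm (T \<tau> x)" for x
  proof -
    have "norm x \<le> exp (\<omega> * \<tau>) * (c * exp (- \<alpha> * \<tau>)) * norm x"
      using mult_right_mono[OF ge1 norm_ge_zero] by simp
    also have "\<dots> \<le> exp (\<omega> * \<tau>) * norm (T \<tau> x)"
      using assms(4)[OF \<open>\<tau> > 0\<close>, of x] by (simp add: mult.assoc)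
    finally show ?thesis .
  qed
  then interpret expanding_semigroup T \<omega> \<tau>
    using assms(1) \<open>\<tau> > 0\<close> by unfold_locales
  obtain M where "M \<ge> 1" "\<And>t. t \<ge> 0 \<Longrightarrow> opnorm quot (induced (S (- t))) \<le> M * exp (\<omega> * t)"
    using opnorm_induced_S_neg by blast
  then show ?thesis
    using banach_cspace_axioms isometric_embedding_delta C0_group_extension_induced opnorm_induced_S_pos
    by (intro exI[of _ quot] exI[of _ "\<lambda>x. coset (delta x)"] exI[of _ "\<lambda>t. induced (S t)"]
        exI[of _ M]) auto
qed

end
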